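(* Let $a_1,\ldots,a_m$ ($m\ge 1$) be distinct points in $\mathbb{R}^n$ and let $\varphi(x):=\sum_{i=1}^m\|x-a_i\|$ for $x\in\mathbb{R}^n$. Then the solution set of the Fermat-Torricelli problem "minimize $\varphi(x)$ subject to $x\in\mathbb{R}^n$" is nonempty; that is, there exists $\bar x\in\mathbb{R}^n$ with $\varphi(\bar x)\le\varphi(x)$ for all $x\in\mathbb{R}^n$.
   Context: $\|\cdot\|$ denotes the Euclidean norm in $\mathbb{R}^n$. A solution of the problem is a global minimizer of $\varphi$ over $\mathbb{R}^n$. *)

theory Defs
  imports "HOL-Analysis.Analysis"
begin

text \<open>The points \<open>a\<^sub>1, \<dots>, a\<^sub>m\<close> are the values of \<open>a\<close> on \<open>{1..m}\<close>; its values elsewhere are irrelevant.\<close>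

definition ft_objective :: "nat \<Rightarrow> (nat \<Rightarrow> real ^ 'n) \<Rightarrow> real ^ 'n \<Rightarrow> real"
  where "ft_objective m a x = (\<Sum>i=1..m. norm (x - a i))"

definition ft_solutions :: "nat \<Rightarrow> (nat \<Rightarrow> real ^ 'n) \<Rightarrow> (real ^ 'n) set"
  where "ft_solutions m a = {y. \<forall>x. ft_objective m a y \<le> ft_objective m a x}"

end

theory Submission
  imports Defs
begin

text \<open>The objective is continuous, so it attains a minimum on a compact ball around
  \<open>a 1\<close>. It dominates each summand (\<open>norm_le_ft_objective\<close>), so with the
  radius equal to its value at \<open>a 1\<close> it is larger outside the ball than at the centre,
  and the minimum is global.\<close>

lemma norm_le_ft_objective:
  assumes "i \<in> {1..m}"
  shows "norm (x - a i) \<le> ft_objective m a x"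
  unfolding ft_objective_def using assms by (intro member_le_sum) auto

lemma ft_objective_nonneg: "0 \<le> ft_objective m a x"
  unfolding ft_objective_def by (intro sum_nonneg) auto

lemma continuous_on_ft_objective: "continuous_on S (ft_objective m a)"
  unfolding ft_objective_def by (intro continuous_intros)

theorem proposition2p2:
  fixes a :: "nat \<Rightarrow> real ^ 'n" and m :: nat
  assumes "m \<ge> 1" and "inj_on a {1..m}"
  shows "ft_solutions m a \<noteq> {}"
proof -
  let ?r = "ft_objective m a (a 1)"
  \<comment> \<open>Outside this ball the single term \<open>norm (x - a 1)\<close> already exceeds the value at its centre.\<close>
  let ?B = "cball (a 1) ?r"
  \<comment> \<open>Used twice: the ball is nonempty, so a minimizer \<open>y\<close> on it exists,
    and \<open>y\<close> does at least as well as the centre, which settles points outside.\<close>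
  have centre: "a 1 \<in> ?B"
    by (simp add: ft_objective_nonneg)
  then obtain y where y: "\<And>x. x \<in> ?B \<Longrightarrow> ft_objective m a y \<le> ft_objective m a x"
    using continuous_attains_inf[OF compact_cball _ continuous_on_ft_objective] by blast
  have "ft_objective m a y \<le> ft_objective m a x" for x
  proof (cases "x \<in> ?B")
    case False
    then have "?r < norm (x - a 1)"
      by (simp add: dist_norm norm_minus_commute)
    also have "\<dots> \<le> ft_objective m a x"
      using assms(1) by (intro norm_le_ft_objective) simp
    finally show ?thesis
      using y[OF centre] by simp
  qed (rule y)
  then show ?thesis
    by (auto simp: ft_solutions_def)
qed

end
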